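(* Let $X$ and $Y$ be linear spaces over a field $\mathbb{K}$ and let $f, f_{1,1}, f_{1,2}, f_{2,1}, f_{2,2}\colon X\times Y\to \mathbb{K}$ be functions that all vanish at $(0,0)$. The functional equation \[ f(x_{1}+x_{2},y_{1})=f_{1,1}(x_{1},y_{1})+f_{1,2}(x_{1},0)+f_{2,1}(x_{2},y_{1})+f_{2,2}(x_{2},0) \qquad (x_{1}, x_{2}\in X,\ y_{1}\in Y) \] is fulfilled if and only if there exist a mapping $A\colon X\times Y\to \mathbb{K}$ additive in its first variable and functions $\chi,\chi_{1,1},\chi_{2,1}\colon X\to \mathbb{K}$ and $\zeta,\zeta_{1,1},\zeta_{2,1}\colon Y\to \mathbb{K}$ vanishing at zero such that $\chi$ is additive, \[ \begin{array}{rcl} f(x,z)&=&A(x,z)+\chi(x)+\zeta(z)\\ f_{1,1}(x,z)&=&A(x,z)+\chi_{1,1}(x)+\zeta_{1,1}(z)\\ f_{2,1}(x,z)&=&A(x,z)+\chi_{2,1}(x)+\zeta_{2,1}(z) \end{array} \qquad (x\in X,\ z\in Y) \] and \[ \begin{array}{rcl} \chi(x)&=&f(x,0)\\ \chi_{1,1}(x)&=&f_{1,1}(x,0)\\ \chi_{2,1}(x)&=&f_{2,1}(x,0)\\ \zeta(z)&=&\zeta_{1,1}(z)+\zeta_{2,1}(z)\\ f_{1,2}(x,0)&=&\chi(x)-\chi_{1,1}(x)\\ f_{2,2}(x,0)&=&\chi(x)-\chi_{2,1}(x) \end{array} \qquad (x\in X,\ z\in Y). \]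
   Context: A function $\chi\colon X\to\mathbb{K}$ is additive if $\chi(x+x')=\chi(x)+\chi(x')$ for all $x,x'\in X$. A mapping $A\colon X\times Y\to\mathbb{K}$ is additive in its first variable if $A(x+x',y)=A(x,y)+A(x',y)$ for all $x,x'\in X$ and $y\in Y$. *)

theory Defs
  imports Complex_Main
begin

definition additive_in_first ::
    "('x::ab_group_add \<times> 'y \<Rightarrow> 'k::ab_group_add) \<Rightarrow> bool" where
  "additive_in_first A \<longleftrightarrow> (\<forall>x x' y. A (x + x', y) = A (x, y) + A (x', y))"

end

theory Submission
  imports Defs
begin

text \<open>
  For each fixed second argument \<open>y\<close> the equation is a Pexider equation
  \<open>p (s + t) = q s + r t\<close> in the first argument, with
  \<open>p = f (\<cdot>, y)\<close>, \<open>q = f11 (\<cdot>, y) + f12 (\<cdot>, 0)\<close> and \<open>r = f21 (\<cdot>, y) + f22 (\<cdot>, 0)\<close>.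
  Its solutions are one additive function shifted by three constants
  (\<open>pexider_additive\<close>, \<open>pexider_left\<close>, \<open>pexider_right\<close>), so
  \<open>f (x, y) - f (0, y)\<close> is additive in \<open>x\<close> for every \<open>y\<close>.

  The slice \<open>y = 0\<close> supplies the additive part \<open>\<chi>\<close>. Subtracting it from the additive part of
  the slice at \<open>y\<close> leaves \<open>A (x, y) = f (x, y) - f (0, y) - f (x, 0)\<close>, which is thus still
  additive in \<open>x\<close> and vanishes at \<open>y = 0\<close>. Comparing the slices at \<open>y\<close> and at \<open>0\<close> also cancels
  the unknowns \<open>f12 (x, 0)\<close> and \<open>f22 (x, 0)\<close>, which is why the same \<open>A\<close> appears in
  \<open>f\<close>, \<open>f11\<close> and \<open>f21\<close>. The converse is a substitution.
\<close>

lemma pexider_left: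
  fixes p q r :: "'a::ab_group_add \<Rightarrow> 'b::ab_group_add"
  assumes "\<And>s t. p (s + t) = q s + r t"
  shows "q s = p s - p 0 + q 0"
  using assms[of s 0] assms[of 0 0] by (simp add: algebra_simps)

lemma pexider_right:
  fixes p q r :: "'a::ab_group_add \<Rightarrow> 'b::ab_group_add"
  assumes "\<And>s t. p (s + t) = q s + r t"
  shows "r t = p t - p 0 + r 0"
  using assms[of 0 t] assms[of 0 0] by (simp add: algebra_simps)

text \<open>
  Both \<open>q\<close> and \<open>r\<close> are translates of \<open>p\<close>, so the equation becomes
  \<open>p (s + t) = p s + p t - 2 p 0 + (q 0 + r 0)\<close>, and the last bracket is \<open>p 0\<close>.
\<close>

lemma pexider_additive:
  fixes p q r :: "'a::ab_group_add \<Rightarrow> 'b::ab_group_add"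
  assumes "\<And>s t. p (s + t) = q s + r t"
  shows "additive (\<lambda>s. p s - p 0)"
proof
  fix s t
  have "p 0 = q 0 + r 0"
    using assms[of 0 0] by simp
  then show "p (s + t) - p 0 = (p s - p 0) + (p t - p 0)"
    using assms[of s t] pexider_left[of p q r s, OF assms] pexider_right[of p q r t, OF assms]
    by (simp add: algebra_simps)
qed

theorem proposition6:
  fixes scaleX :: "'k::field \<Rightarrow> 'x::ab_group_add \<Rightarrow> 'x"
    and scaleY :: "'k \<Rightarrow> 'y::ab_group_add \<Rightarrow> 'y"
    and f f11 f12 f21 f22 :: "'x \<times> 'y \<Rightarrow> 'k"
  assumes "vector_space scaleX" and "vector_space scaleY"
    and "f (0, 0) = 0"
    and "f11 (0, 0) = 0" and "f12 (0, 0) = 0"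
    and "f21 (0, 0) = 0" and "f22 (0, 0) = 0"
  shows "(\<forall>x1 x2 y1. f (x1 + x2, y1)
             = f11 (x1, y1) + f12 (x1, 0) + f21 (x2, y1) + f22 (x2, 0))
    \<longleftrightarrow>
    (\<exists>(A :: 'x \<times> 'y \<Rightarrow> 'k)
       (\<chi> :: 'x \<Rightarrow> 'k) (\<chi>11 :: 'x \<Rightarrow> 'k) (\<chi>21 :: 'x \<Rightarrow> 'k)
       (\<zeta> :: 'y \<Rightarrow> 'k) (\<zeta>11 :: 'y \<Rightarrow> 'k) (\<zeta>21 :: 'y \<Rightarrow> 'k).
       additive_in_first A \<and>
       \<chi> 0 = 0 \<and> \<chi>11 0 = 0 \<and> \<chi>21 0 = 0 \<and>
       \<zeta> 0 = 0 \<and> \<zeta>11 0 = 0 \<and> \<zeta>21 0 = 0 \<and>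
       additive \<chi> \<and>
       (\<forall>x z. f (x, z) = A (x, z) + \<chi> x + \<zeta> z \<and>
              f11 (x, z) = A (x, z) + \<chi>11 x + \<zeta>11 z \<and>
              f21 (x, z) = A (x, z) + \<chi>21 x + \<zeta>21 z) \<and>
       (\<forall>x z. \<chi> x = f (x, 0) \<and>
              \<chi>11 x = f11 (x, 0) \<and>
              \<chi>21 x = f21 (x, 0) \<and>
              \<zeta> z = \<zeta>11 z + \<zeta>21 z \<and>
              f12 (x, 0) = \<chi> x - \<chi>11 x \<and>
              f22 (x, 0) = \<chi> x - \<chi>21 x))"
  (is "?eq \<longleftrightarrow> ?rep")
proof
  assume ?eq
  then have pexider: "f (s + t, y) = (f11 (s, y) + f12 (s, 0)) + (f21 (t, y) + f22 (t, 0))"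
    for s t y
    by (simp add: algebra_simps)
  have add: "additive (\<lambda>s. f (s, y) - f (0, y))" for y
    by (rule pexider_additive) (rule pexider)
  have left: "f11 (s, y) + f12 (s, 0) = f (s, y) - f (0, y) + f11 (0, y)" for s y
    using pexider_left[of "\<lambda>s. f (s, y)", OF pexider] assms by simp
  have right: "f21 (t, y) + f22 (t, 0) = f (t, y) - f (0, y) + f21 (0, y)" for t y
    using pexider_right[of "\<lambda>s. f (s, y)", OF pexider] assms by simp
  have chi: "f12 (s, 0) = f (s, 0) - f11 (s, 0)" "f22 (s, 0) = f (s, 0) - f21 (s, 0)" for s
    using left[of s 0] right[of s 0] assms by (simp_all add: algebra_simps)
  define A where "A = (\<lambda>(x, y). f (x, y) - f (0, y) - f (x, 0))"
  have additive_slice: "additive (\<lambda>x. f (x, 0))"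
    using add[of 0] assms by simp
  have "additive_in_first A"
    unfolding additive_in_first_def
  proof (intro allI)
    fix x x' y
    show "A (x + x', y) = A (x, y) + A (x', y)"
      using additive.add[OF add, of x x' y] additive.add[OF additive_slice, of x x']
      by (simp add: A_def algebra_simps)
  qed
  moreover have "f (x, z) = A (x, z) + f (x, 0) + f (0, z)" for x z
    by (simp add: A_def)
  moreover have "f11 (x, z) = A (x, z) + f11 (x, 0) + f11 (0, z)" for x z
    using left[of x z] chi(1)[of x] by (simp add: A_def algebra_simps)
  moreover have "f21 (x, z) = A (x, z) + f21 (x, 0) + f21 (0, z)" for x z
    using right[of x z] chi(2)[of x] by (simp add: A_def algebra_simps)
  moreover have "f (0, z) = f11 (0, z) + f21 (0, z)" for z
    using pexider[of 0 0 z] assms by simp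
  ultimately show ?rep
    using assms additive_slice chi
    by - (rule exI[of _ A], rule exI[of _ "\<lambda>x. f (x, 0)"], rule exI[of _ "\<lambda>x. f11 (x, 0)"],
        rule exI[of _ "\<lambda>x. f21 (x, 0)"], rule exI[of _ "\<lambda>z. f (0, z)"],
        rule exI[of _ "\<lambda>z. f11 (0, z)"], rule exI[of _ "\<lambda>z. f21 (0, z)"], blast)
next
  assume ?rep
  then obtain A \<chi> \<chi>11 \<chi>21 \<zeta> \<zeta>11 \<zeta>21 where
    A: "additive_in_first A" and \<chi>: "additive \<chi>"
    and f: "\<And>x z. f (x, z) = A (x, z) + \<chi> x + \<zeta> z"
    and f11: "\<And>x z. f11 (x, z) = A (x, z) + \<chi>11 x + \<zeta>11 z"
    and f21: "\<And>x z. f21 (x, z) = A (x, z) + \<chi>21 x + \<zeta>21 z"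
    and \<zeta>: "\<And>z. \<zeta> z = \<zeta>11 z + \<zeta>21 z"
    and f12: "\<And>x. f12 (x, 0) = \<chi> x - \<chi>11 x"
    and f22: "\<And>x. f22 (x, 0) = \<chi> x - \<chi>21 x"
    by blast
  have "A (x + x', y) = A (x, y) + A (x', y)" for x x' y
    using A by (simp add: additive_in_first_def)
  then show ?eq
    using additive.add[OF \<chi>] by (simp only: f f11 f21 f12 f22 \<zeta>) (simp add: algebra_simps)
qed

end
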